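(* Let $(X,d,\preceq)$ be an ordered metric space, $E$ an O-complete subspace of $X$ and $\ast\in\mathcal{U}_{\iota_n}$. Let $F:X^{n}\to X$ and $g:X\to X$ be two mappings. Suppose that the following conditions (i)-(vi) hold: (i) $F(X^n)\subseteq g(X)\cap E$; (ii) $F$ has the $\iota_n$-mixed $g$-monotone property; (iii) $F$ and $g$ are $(\ast,\mathrm{O})$-compatible; (iv) $g$ is O-continuous; (v) either $F$ is O-continuous or $(E,d,\preceq)$ has the $g$-MCB property; (vi) there exist $x^{(0)}_1,\dots,x^{(0)}_n\in X$ such that either [$g(x^{(0)}_i)\preceq F(x^{(0)}_{i_1},\dots,x^{(0)}_{i_n})$ for each $i\in A$ and $g(x^{(0)}_i)\succeq F(x^{(0)}_{i_1},\dots,x^{(0)}_{i_n})$ for each $i\in B$], or [$g(x^{(0)}_i)\succeq F(x^{(0)}_{i_1},\dots,x^{(0)}_{i_n})$ for each $i\in A$ and $g(x^{(0)}_i)\preceq F(x^{(0)}_{i_1},\dots,x^{(0)}_{i_n})$ for each $i\in B$]. Suppose moreover that at least one of the following two conditions holds: (vii) there exists $\varphi\in\Omega$ such that $$\frac1n\sum_{i=1}^n d\big(F(x_{i_1},\dots,x_{i_n}),F(y_{i_1},\dots,y_{i_n})\big)\le\varphi\Big(\frac1n\sum_{i=1}^n d(gx_i,gy_i)\Big)$$ for all $x_1,\dots,x_n,y_1,\dots,y_n\in X$ with [$g(x_i)\preceq g(y_i)$ for each $i\in A$ and $g(x_i)\succeq g(y_i)$ for each $i\in B$] or [$g(x_i)\succeq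 g(y_i)$ for each $i\in A$ and $g(x_i)\preceq g(y_i)$ for each $i\in B$]; (vii$'$) there exists $\varphi\in\Omega$ such that $$\max_{i\in I_n} d\big(F(x_{i_1},\dots,x_{i_n}),F(y_{i_1},\dots,y_{i_n})\big)\le\varphi\Big(\max_{i\in I_n} d(gx_i,gy_i)\Big)$$ for all $x_1,\dots,x_n,y_1,\dots,y_n\in X$ with [$g(x_i)\preceq g(y_i)$ for each $i\in A$ and $g(x_i)\succeq g(y_i)$ for each $i\in B$] or [$g(x_i)\succeq g(y_i)$ for each $i\in A$ and $g(x_i)\preceq g(y_i)$ for each $i\in B$]. Then $F$ and $g$ have an $\ast$-coincidence point.
   Context: Fix an integer $n\ge 2$, put $I_n=\{1,\dots,n\}$, and let $\iota_n=\{A,B\}$ be a fixed partition of $I_n$ into two nonempty disjoint subsets $A,B$. For a binary operation $\ast:I_n\times I_n\to I_n$ write $i_k:=\ast(i,k)$. $\mathcal{U}_{\iota_n}$ is the set of all binary operations $\ast$ on $I_n$ with $\ast(A\times A)\subseteq A$, $\ast(A\times B)\subseteq B$, $\ast(B\times A)\subseteq B$, $\ast(B\times B)\subseteq A$. We write $gx$ for $g(x)$. An ordered metric space $(X,d,\preceq)$ is a nonempty set $X$ with a metric $d$ and a partial order $\preceq$; $x\succeq y$ means $y\preceq x$. A subspace is a nonempty subset with the restricted metric and order. Sequences are indexed by $m\in\mathbb{N}_0=\{0,1,2,\dots\}$. A sequence is increasing (decreasing) if $x^{(m)}\preceq x^{(l)}$ ($x^{(m)}\succeq x^{(l)}$)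 whenever $m<l$, and monotone if it is increasing or decreasing. $x^{(m)}\uparrow x$ (resp. $\downarrow x$, $\uparrow\downarrow x$) means $\{x^{(m)}\}$ is increasing (resp. decreasing, monotone) and converges to $x$ in $d$. An ordered metric space is O-complete if every monotone Cauchy sequence in it converges in it. $F:X^n\to X$ has the $\iota_n$-mixed $g$-monotone property if, with all other arguments fixed arbitrarily, $g(\underline{x}_i)\preceq g(\overline{x}_i)$ implies $F(\dots,\underline{x}_i,\dots)\preceq F(\dots,\overline{x}_i,\dots)$ ($i$-th argument) when $i\in A$, and $F(\dots,\underline{x}_i,\dots)\succeq F(\dots,\overline{x}_i,\dots)$ when $i\in B$. $F$ and $g$ are $(\ast,\mathrm{O})$-compatible if for all sequences $\{x_1^{(m)}\},\dots,\{x_n^{(m)}\}$ in $X$ and all $z_1,\dots,z_n\in X$: if $g(x_i^{(m)})\uparrow\downarrow z_i$ and $F(x_{i_1}^{(m)},\dots,x_{i_n}^{(m)})\uparrow\downarrow z_i$ for each $i\in I_n$, then $\lim_{m\to\infty} d\big(gF(x_{i_1}^{(m)},\dots,x_{i_n}^{(m)}),F(gx_{i_1}^{(m)},\dots,gx_{i_n}^{(m)})\big)=0$ for each $i\in I_n$. $g$ is O-continuous if $x^{(m)}\uparrow\downarrow x$ implies $g(x^{(m)})\to g(x)$. $F$ is O-continuous if $x_i^{(m)}\uparrow\downarrow x_i$ for all $i\in I_n$ implies $F(x_1^{(m)},\dots,x_n^{(m)})\to F(x_1,\dots,x_n)$. $(E,d,\preceq)$ has the $g$-MCB property if for every sequence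 $\{x^{(m)}\}$ in $E$ and $x\in E$: $x^{(m)}\uparrow x$ implies $g(x^{(m)})\preceq g(x)$ for all $m$, and $x^{(m)}\downarrow x$ implies $g(x^{(m)})\succeq g(x)$ for all $m$. $\Omega$ is the set of functions $\varphi:[0,\infty)\to[0,\infty)$ with $\varphi(t)<t$ and $\limsup_{r\to t^+}\varphi(r)<t$ for every $t>0$. An $\ast$-coincidence point of $F$ and $g$ is $(x_1,\dots,x_n)\in X^n$ with $F(x_{i_1},\dots,x_{i_n})=g(x_i)$ for each $i\in I_n$. *)

theory Defs
  imports "HOL-Analysis.Analysis"
begin

text \<open>
  The ordered metric space X is a type of sort \<open>{metric_space, order}\<close>, the index set
  \<open>{1, ..., n}\<close> is a finite type \<open>'n\<close> with \<open>n = CARD('n)\<close>, and the n-fold power of X is the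
  function space \<open>'n \<Rightarrow> 'a\<close>.  The order and the metric are not assumed to be related.
\<close>

definition bipartition :: "'n set \<Rightarrow> 'n set \<Rightarrow> bool" where
  "bipartition A B \<longleftrightarrow> A \<union> B = UNIV \<and> A \<inter> B = {} \<and> A \<noteq> {} \<and> B \<noteq> {}"

definition graded_ops :: "'n set \<Rightarrow> 'n set \<Rightarrow> ('n \<Rightarrow> 'n \<Rightarrow> 'n) set" where
  "graded_ops A B = {ast.
     (\<forall>i\<in>A. \<forall>k\<in>A. ast i k \<in> A) \<and> (\<forall>i\<in>A. \<forall>k\<in>B. ast i k \<in> B) \<and>
     (\<forall>i\<in>B. \<forall>k\<in>A. ast i k \<in> B) \<and> (\<forall>i\<in>B. \<forall>k\<in>B. ast i k \<in> A)}"

text \<open>The i-th component of \<open>ast_map ast F x\<close> is \<open>F (x\<^sub>i\<^sub>1, ..., x\<^sub>i\<^sub>n)\<close>, the inner indices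
  being the products \<open>ast i 1, ..., ast i n\<close>.\<close>

definition ast_map :: "('n \<Rightarrow> 'n \<Rightarrow> 'n) \<Rightarrow> (('n \<Rightarrow> 'a) \<Rightarrow> 'b) \<Rightarrow> ('n \<Rightarrow> 'a) \<Rightarrow> 'n \<Rightarrow> 'b" where
  "ast_map ast F x i = F (\<lambda>k. x (ast i k))"

definition mixed_le :: "'n set \<Rightarrow> 'n set \<Rightarrow> ('n \<Rightarrow> 'a::order) \<Rightarrow> ('n \<Rightarrow> 'a) \<Rightarrow> bool" where
  "mixed_le A B x y \<longleftrightarrow> (\<forall>i\<in>A. x i \<le> y i) \<and> (\<forall>i\<in>B. x i \<ge> y i)"

definition tendsto_incseq :: "(nat \<Rightarrow> 'a::{metric_space, order}) \<Rightarrow> 'a \<Rightarrow> bool" where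
  "tendsto_incseq x l \<longleftrightarrow> incseq x \<and> x \<longlonglongrightarrow> l"

definition tendsto_decseq :: "(nat \<Rightarrow> 'a::{metric_space, order}) \<Rightarrow> 'a \<Rightarrow> bool" where
  "tendsto_decseq x l \<longleftrightarrow> decseq x \<and> x \<longlonglongrightarrow> l"

definition tendsto_monoseq :: "(nat \<Rightarrow> 'a::{metric_space, order}) \<Rightarrow> 'a \<Rightarrow> bool" where
  "tendsto_monoseq x l \<longleftrightarrow> monoseq x \<and> x \<longlonglongrightarrow> l"

definition O_complete :: "'a::{metric_space, order} set \<Rightarrow> bool" where
  "O_complete E \<longleftrightarrow>
     (\<forall>x. (\<forall>m. x m \<in> E) \<and> monoseq x \<and> Cauchy x \<longrightarrow> (\<exists>l\<in>E. x \<longlonglongrightarrow> l))"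

definition mixed_g_monotone ::
  "'n set \<Rightarrow> 'n set \<Rightarrow> ('a::order \<Rightarrow> 'a) \<Rightarrow> (('n \<Rightarrow> 'a) \<Rightarrow> 'a) \<Rightarrow> bool" where
  "mixed_g_monotone A B g F \<longleftrightarrow>
     (\<forall>i\<in>A. \<forall>x a b. g a \<le> g b \<longrightarrow> F (x(i := a)) \<le> F (x(i := b))) \<and>
     (\<forall>i\<in>B. \<forall>x a b. g a \<le> g b \<longrightarrow> F (x(i := a)) \<ge> F (x(i := b)))"

text \<open>In the next definition \<open>x m i\<close> is the m-th term of the i-th sequence.\<close>

definition O_compatible ::
  "('n \<Rightarrow> 'n \<Rightarrow> 'n) \<Rightarrow> (('n \<Rightarrow> 'a::{metric_space, order}) \<Rightarrow> 'a) \<Rightarrow> ('a \<Rightarrow> 'a) \<Rightarrow> bool" where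
  "O_compatible ast F g \<longleftrightarrow>
     (\<forall>(x :: nat \<Rightarrow> 'n \<Rightarrow> 'a) z.
        (\<forall>i. tendsto_monoseq (\<lambda>m. g (x m i)) (z i) \<and>
             tendsto_monoseq (\<lambda>m. ast_map ast F (x m) i) (z i)) \<longrightarrow>
        (\<forall>i. (\<lambda>m. dist (g (ast_map ast F (x m) i))
                         (ast_map ast F (\<lambda>j. g (x m j)) i)) \<longlonglongrightarrow> 0))"

definition O_continuous :: "('a::{metric_space, order} \<Rightarrow> 'a) \<Rightarrow> bool" where
  "O_continuous g \<longleftrightarrow> (\<forall>x l. tendsto_monoseq x l \<longrightarrow> (\<lambda>m. g (x m)) \<longlonglongrightarrow> g l)"

text \<open>The sequences in different coordinates need not be monotone in the same direction.\<close>

definition O_continuous_multi ::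
  "(('n \<Rightarrow> 'a::{metric_space, order}) \<Rightarrow> 'a) \<Rightarrow> bool" where
  "O_continuous_multi F \<longleftrightarrow>
     (\<forall>(x :: nat \<Rightarrow> 'n \<Rightarrow> 'a) l.
        (\<forall>i. tendsto_monoseq (\<lambda>m. x m i) (l i)) \<longrightarrow> (\<lambda>m. F (x m)) \<longlonglongrightarrow> F l)"

definition MCB :: "('a::{metric_space, order} \<Rightarrow> 'a) \<Rightarrow> 'a set \<Rightarrow> bool" where
  "MCB g E \<longleftrightarrow>
     (\<forall>x l. (\<forall>m. x m \<in> E) \<and> l \<in> E \<longrightarrow>
        (tendsto_incseq x l \<longrightarrow> (\<forall>m. g (x m) \<le> g l)) \<and>
        (tendsto_decseq x l \<longrightarrow> (\<forall>m. g (x m) \<ge> g l)))"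

text \<open>A function on \<open>[0, \<infinity>)\<close> is a function on the reals whose values at negative arguments
  are irrelevant.  The upper limit is taken in the extended reals, as it may be infinite.
  The value at 0 is constrained only to be nonnegative.\<close>

definition Omega :: "(real \<Rightarrow> real) set" where
  "Omega = {\<phi>. (\<forall>t\<ge>0. \<phi> t \<ge> 0) \<and>
     (\<forall>t>0. \<phi> t < t \<and> Limsup (at_right t) (\<lambda>r. ereal (\<phi> r)) < ereal t)}"

definition ast_coincidence_point ::
  "('n \<Rightarrow> 'n \<Rightarrow> 'n) \<Rightarrow> (('n \<Rightarrow> 'a) \<Rightarrow> 'a) \<Rightarrow> ('a \<Rightarrow> 'a) \<Rightarrow> ('n \<Rightarrow> 'a) \<Rightarrow> bool" where
  "ast_coincidence_point ast F g x \<longleftrightarrow> (\<forall>i. ast_map ast F x i = g (x i))"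

end

theory Submission
  imports Defs
begin

text \<open>
  Write T for \<open>ast_map ast F\<close>.  Since \<open>ast\<close> respects the grading, T is monotone for
  \<open>mixed_le\<close>, so picking preimages under g of the values of T yields a Picard-type sequence
  \<open>y (m + 1) = g (x (m + 1)) = T (x m)\<close> that is a chain for \<open>mixed_le\<close>.  Both contraction
  conditions are of Meir-Keeler type for a metric D on the product, which makes y a D-Cauchy
  sequence; its coordinates are monotone, so they converge to some z by O-completeness.
  Compatibility and O-continuity of g give \<open>T (y m) \<longlonglongrightarrow> g z\<close>, while either alternative in the
  continuity hypothesis gives \<open>T (y m) \<longlonglongrightarrow> T z\<close>.
\<close>

section \<open>Meir-Keeler conditions and Cauchy sequences\<close>

text \<open>The bound on the upper limit controls \<phi> only on some interval to the right of
  \<open>t\<close>; for \<open>0 < r \<le> t\<close> the inequality \<open>\<phi> r < r\<close>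
  takes over.\<close>

lemma Omega_gap:
  assumes "\<phi> \<in> Omega" "0 < t"
  obtains e where "0 < e" "\<And>r. 0 < r \<Longrightarrow> r < t + e \<Longrightarrow> \<phi> r < t"
proof -
  have lt: "\<phi> s < s" if "0 < s" for s
    using assms that by (auto simp: Omega_def)
  have "Limsup (at_right t) (\<lambda>r. ereal (\<phi> r)) < ereal t"
    using assms by (auto simp: Omega_def)
  then have "\<forall>\<^sub>F r in at_right t. \<phi> r < t"
    using Limsup_lessD by fastforce
  then obtain b where b: "t < b" "\<And>r. t < r \<Longrightarrow> r < b \<Longrightarrow> \<phi> r < t"
    by (auto simp: eventually_at_right_field)
  show thesis
  proof (rule that[of "b - t"])
    fix r assume r: "0 < r" "r < t + (b - t)"
    then show "\<phi> r < t"
      using lt[of r] b(2)[of r] by (cases "r \<le> t") auto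
  qed (use b in auto)
qed

text \<open>Were the infimum of the step lengths positive, a step close to it would be followed by
  one below it; so arbitrarily short steps occur. One short step at \<open>y N\<close> then traps
  all later terms in a ball about \<open>y N\<close>.\<close>

lemma Meir_Keeler_Cauchy:
  fixes D :: "'b \<Rightarrow> 'b \<Rightarrow> real" and y :: "nat \<Rightarrow> 'b"
  assumes nonneg: "\<And>u v. 0 \<le> D u v"
    and sym: "\<And>u v. D u v = D v u"
    and tri: "\<And>u v w. D u w \<le> D u v + D v w"
    and refl: "\<And>u. D u u = 0"
    and MK: "\<And>\<epsilon>. 0 < \<epsilon> \<Longrightarrow>
       \<exists>e>0. \<forall>m l. D (y m) (y l) < \<epsilon> + e \<longrightarrow> D (y (Suc m)) (y (Suc l)) < \<epsilon>"
    and "0 < \<epsilon>"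
  shows "\<exists>N. \<forall>m\<ge>N. \<forall>l\<ge>N. D (y m) (y l) < \<epsilon>"
proof -
  define \<delta> where "\<delta> = (INF m. D (y m) (y (Suc m)))"
  have bdd: "bdd_below (range (\<lambda>m. D (y m) (y (Suc m))))"
    using nonneg by (auto intro!: bdd_belowI)
  have "\<delta> \<le> 0"
  proof (rule ccontr)
    assume "\<not> \<delta> \<le> 0"
    then obtain e where e: "e > 0"
        "\<And>m l. D (y m) (y l) < \<delta> + e \<Longrightarrow> D (y (Suc m)) (y (Suc l)) < \<delta>"
      using MK[of \<delta>] by auto
    obtain m where "D (y m) (y (Suc m)) < \<delta> + e"
      using e(1) cINF_less_iff[OF _ bdd, of "\<delta> + e"] by (auto simp: \<delta>_def)
    from e(2)[OF this] cINF_lower[OF bdd, of "Suc m"] show False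
      by (simp add: \<delta>_def)
  qed
  obtain e where e: "e > 0"
      "\<And>m l. D (y m) (y l) < \<epsilon>/4 + e \<Longrightarrow> D (y (Suc m)) (y (Suc l)) < \<epsilon>/4"
    using MK[of "\<epsilon>/4"] \<open>0 < \<epsilon>\<close> by auto
  \<comment> \<open>The bound by \<open>e\<close> lets the Meir-Keeler condition act on the ball of
    radius \<open>\<epsilon>/4 + e'\<close>; the bound by \<open>\<epsilon>/4\<close> keeps that
    radius within \<open>\<epsilon>/2\<close>.\<close>
  define e' where "e' = min e (\<epsilon>/4)"
  have e': "0 < e'" "e' \<le> e" "e' \<le> \<epsilon>/4"
    using e(1) \<open>0 < \<epsilon>\<close> by (auto simp: e'_def)
  obtain N where N: "D (y N) (y (Suc N)) < e'"
    using e'(1) \<open>\<delta> \<le> 0\<close> cINF_less_iff[OF _ bdd, of e'] by (auto simp: \<delta>_def)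
  \<comment> \<open>Shifting both indices brings the distance below \<open>\<epsilon>/4\<close>, and
    returning from \<open>y (Suc N)\<close> to \<open>y N\<close> costs less than \<open>e'\<close>,
    so the ball is never left.\<close>
  have near: "D (y N) (y (N + k)) < \<epsilon>/4 + e'" for k
  proof (induction k)
    case 0
    then show ?case using refl e' \<open>0 < \<epsilon>\<close> by simp
  next
    case (Suc k)
    then have "D (y (Suc N)) (y (Suc (N + k))) < \<epsilon>/4"
      using e(2) e'(2) by fastforce
    then show ?case
      using N tri[of "y N" "y (N + Suc k)" "y (Suc N)"] by simp
  qed
  have close: "D (y N) (y m) < \<epsilon>/2" if "N \<le> m" for m
    using near[of "m - N"] that e'(3) by simp
  have "D (y m) (y l) < \<epsilon>" if "N \<le> m" "N \<le> l" for m l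
    using close[OF that(1)] close[OF that(2)] tri[of "y m" "y l" "y N"] sym[of "y m" "y N"]
    by simp
  then show ?thesis by blast
qed

section \<open>The mixed order on the product\<close>

lemma mixed_le_swap: "mixed_le B A x y \<longleftrightarrow> mixed_le A B y x"
  by (auto simp: mixed_le_def)

lemma mixed_le_refl: "mixed_le A B x x"
  by (simp add: mixed_le_def)

lemma mixed_le_trans: "mixed_le A B x y \<Longrightarrow> mixed_le A B y z \<Longrightarrow> mixed_le A B x z"
  by (auto simp: mixed_le_def intro: order_trans)

lemma mixed_le_antisym:
  assumes "A \<union> B = UNIV" "mixed_le A B x y" "mixed_le A B y x"
  shows "x = y"
proof
  fix i
  from assms(1) have "i \<in> A \<or> i \<in> B" by auto
  with assms(2,3) show "x i = y i" by (auto simp: mixed_le_def intro: order_antisym)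
qed

text \<open>Mixed monotonicity varies one argument at a time; here the entries of \<open>u\<close>
  are replaced by those of \<open>v\<close> one after another, by induction over the set of replaced
  indices.\<close>

lemma mixed_g_monotone_le:
  fixes F :: "('n::finite \<Rightarrow> 'a::order) \<Rightarrow> 'a"
  assumes "mixed_g_monotone A B g F" "A \<union> B = UNIV"
    and "\<And>k. k \<in> A \<Longrightarrow> g (u k) \<le> g (v k)"
    and "\<And>k. k \<in> B \<Longrightarrow> g (v k) \<le> g (u k)"
  shows "F u \<le> F v"
proof -
  have "F u \<le> F (override_on u v S)" for S
  proof (induction S rule: finite_induct[OF finite])
    case (2 k S)
    define w where "w = override_on u v S"
    \<comment> \<open>Since \<open>k\<close> is outside \<open>S\<close>, the entry of
      \<open>w\<close> at \<open>k\<close> is still \<open>u k\<close>, so the two points differ by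
      an update at \<open>k\<close> alone.\<close>
    have w: "w = w(k := u k)" "override_on u v (insert k S) = w(k := v k)"
      using 2 by (auto simp: w_def override_on_def fun_eq_iff)
    have "k \<in> A \<or> k \<in> B"
      using assms(2) by auto
    then have "F (w(k := u k)) \<le> F (w(k := v k))"
      using assms(1,3,4) unfolding mixed_g_monotone_def by blast
    with 2 w show ?case by (metis order_trans w_def)
  qed simp
  from this[of UNIV] show ?thesis by (simp add: override_on_def)
qed

text \<open>For \<open>i\<close> in \<open>A\<close> the map \<open>ast i\<close> preserves
  \<open>A\<close> and \<open>B\<close>, so the rearranged tuples compare as before; for
  \<open>i\<close> in \<open>B\<close> it exchanges them and the comparison reverses, which is what
  \<open>mixed_le\<close> asks on \<open>B\<close>.\<close>

lemma ast_map_mono: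
  fixes F :: "('n::finite \<Rightarrow> 'a::order) \<Rightarrow> 'a"
  assumes "mixed_g_monotone A B g F" "A \<union> B = UNIV" "ast \<in> graded_ops A B"
    and le: "mixed_le A B (\<lambda>i. g (x i)) (\<lambda>i. g (y i))"
  shows "mixed_le A B (ast_map ast F x) (ast_map ast F y)"
  unfolding mixed_le_def ast_map_def
proof (intro conjI ballI)
  fix i assume "i \<in> A"
  then show "F (\<lambda>k. x (ast i k)) \<le> F (\<lambda>k. y (ast i k))"
    using assms(3) le
    by (intro mixed_g_monotone_le[OF assms(1,2)]) (auto simp: graded_ops_def mixed_le_def)
next
  fix i assume "i \<in> B"
  then show "F (\<lambda>k. y (ast i k)) \<le> F (\<lambda>k. x (ast i k))"
    using assms(3) le
    by (intro mixed_g_monotone_le[OF assms(1,2)]) (auto simp: graded_ops_def mixed_le_def)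
qed

lemma mixed_le_chain_coordinate:
  assumes "\<And>m. mixed_le A B (y m) (y (Suc m))"
  shows "i \<in> A \<Longrightarrow> incseq (\<lambda>m. y m i)" "i \<in> B \<Longrightarrow> decseq (\<lambda>m. y m i)"
  using assms by (auto simp: mixed_le_def incseq_Suc_iff decseq_Suc_iff)

section \<open>Convergence of the Picard-type sequence\<close>

text \<open>Meant for \<open>y m i\<close>, whose initial term \<open>g (x0 i)\<close> may lie
  outside \<open>E\<close>; only values of \<open>F\<close> are known to lie in
  \<open>E\<close>.\<close>

lemma O_complete_shifted:
  assumes "O_complete E" "\<And>m. x (Suc m) \<in> E" "monoseq x" "Cauchy x"
  shows "\<exists>l\<in>E. x \<longlonglongrightarrow> l"
proof -
  have "monoseq (\<lambda>m. x (Suc m))"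
    using assms(3) unfolding monoseq_def by (meson Suc_le_mono)
  moreover have "Cauchy (\<lambda>m. x (Suc m))"
    using Cauchy_subseq_Cauchy[OF assms(4), of Suc] by (simp add: comp_def strict_mono_Suc_iff)
  ultimately obtain l where "l \<in> E" "(\<lambda>m. x (Suc m)) \<longlonglongrightarrow> l"
    using assms(1,2) unfolding O_complete_def by meson
  then show ?thesis
    by (auto intro: LIMSEQ_imp_Suc)
qed

text \<open>The hypotheses are symmetric under exchanging A and B, which reverses \<open>mixed_le\<close>; so
  this also covers a starting point lying above its image.\<close>

lemma coincidence_of_Meir_Keeler:
  fixes A B :: "'n::finite set"
    and F :: "('n \<Rightarrow> 'a::{metric_space, order}) \<Rightarrow> 'a"
    and D :: "('n \<Rightarrow> 'a) \<Rightarrow> ('n \<Rightarrow> 'a) \<Rightarrow> real"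
  assumes AB: "A \<union> B = UNIV"
    and E: "O_complete E" "range F \<subseteq> range g \<inter> E"
    and mono: "\<And>x y. mixed_le A B (\<lambda>i. g (x i)) (\<lambda>i. g (y i)) \<Longrightarrow>
                 mixed_le A B (ast_map ast F x) (ast_map ast F y)"
    and compat: "O_compatible ast F g"
    and g: "O_continuous g"
    and FE: "O_continuous_multi F \<or> MCB g E"
    and x0: "mixed_le A B (\<lambda>i. g (x0 i)) (ast_map ast F x0)"
    and D_sym: "\<And>u v. D u v = D v u"
    and D_tri: "\<And>u v w. D u w \<le> D u v + D v w"
    and D_lower: "\<And>u v i. dist (u i) (v i) \<le> C * D u v"
    and D_upper: "\<And>u v. D u v \<le> (\<Sum>i\<in>UNIV. dist (u i) (v i))"
    and MK: "\<And>\<epsilon>. 0 < \<epsilon> \<Longrightarrow> \<exists>e>0. \<forall>x y.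
       mixed_le A B (\<lambda>i. g (x i)) (\<lambda>i. g (y i)) \<longrightarrow> D (\<lambda>i. g (x i)) (\<lambda>i. g (y i)) < \<epsilon> + e \<longrightarrow>
       D (ast_map ast F x) (ast_map ast F y) < \<epsilon>"
  shows "\<exists>x. ast_coincidence_point ast F g x"
proof -
  define T where "T = ast_map ast F"
  have T_ran: "T x i \<in> range g" "T x i \<in> E" for x i
    using E(2) by (auto simp: T_def ast_map_def)
  \<comment> \<open>\<open>D_upper\<close> bounds \<open>D u u\<close> above by 0, and the triangle
    inequality \<open>D u u \<le> D u u + D u u\<close> bounds it below.\<close>
  have D_refl: "D u u = 0" for u
    using D_upper[of u u] D_tri[of u u u] by simp
  have D_nonneg: "0 \<le> D u v" for u v
    using D_tri[of u u v] D_sym[of u v] D_refl[of u] by simp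
  have "\<exists>x'. \<forall>i. g (x' i) = T x i" for x
    using T_ran(1)[of x] by (intro choice) (metis rangeE)
  then obtain next_pt where next_pt: "\<And>x i. g (next_pt x i) = T x i"
    by metis
  define x where "x m = (next_pt ^^ m) x0" for m
  define y where "y m i = g (x m i)" for m i
  have y_Suc: "y (Suc m) = T (x m)" for m
    by (simp add: y_def x_def next_pt fun_eq_iff)
  have step: "mixed_le A B (y m) (y (Suc m))" for m
  proof (induction m)
    case 0
    show ?case
      using x0 by (simp add: y_Suc) (simp add: y_def x_def T_def)
  next
    case (Suc m)
    then show ?case
      using mono[of "x m" "x (Suc m)"] unfolding y_Suc[symmetric] T_def[symmetric]
      by (simp add: y_def[abs_def])
  qed
  have chain: "mixed_le A B (y m) (y l)" if "m \<le> l" for m l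
    using that by (induction rule: dec_induct) (auto intro: mixed_le_refl mixed_le_trans step)
  have y_MK: "\<exists>e>0. \<forall>m l. D (y m) (y l) < \<epsilon> + e \<longrightarrow> D (y (Suc m)) (y (Suc l)) < \<epsilon>"
    if \<epsilon>: "0 < \<epsilon>" for \<epsilon>
  proof -
    obtain e where e: "e > 0" "\<And>u v. mixed_le A B (\<lambda>i. g (u i)) (\<lambda>i. g (v i)) \<Longrightarrow>
        D (\<lambda>i. g (u i)) (\<lambda>i. g (v i)) < \<epsilon> + e \<Longrightarrow> D (T u) (T v) < \<epsilon>"
      using MK[OF \<epsilon>] unfolding T_def by blast
    have "D (y (Suc m)) (y (Suc l)) < \<epsilon>" if "m \<le> l" "D (y m) (y l) < \<epsilon> + e" for m l
      unfolding y_Suc using e(2)[of "x m" "x l"] chain[OF that(1)] that(2)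
      by (simp add: y_def[abs_def])
    \<comment> \<open>For \<open>m > l\<close> the chain is ordered the other way, and symmetry of
      \<open>D\<close> reduces to the previous case.\<close>
    then have "D (y (Suc m)) (y (Suc l)) < \<epsilon>" if "D (y m) (y l) < \<epsilon> + e" for m l
      using that D_sym by (metis nle_le)
    with e(1) show ?thesis by blast
  qed
  \<comment> \<open>The sign of \<open>C\<close> is unspecified; \<open>max C 1\<close> is a
    positive constant by which tolerances can be divided.\<close>
  have D_lower': "dist (u i) (v i) \<le> max C 1 * D u v" for u v i
    using D_lower[of u i v] D_nonneg[of u v] by (meson max.cobounded1 mult_right_mono order_trans)
  have "Cauchy (\<lambda>m. y m i)" for i
  proof (rule metric_CauchyI)
    fix \<epsilon> :: real assume "0 < \<epsilon>"
    then have "0 < \<epsilon> / max C 1" by auto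
    from Meir_Keeler_Cauchy[of D, OF D_nonneg D_sym D_tri D_refl y_MK this]
    obtain N where N: "\<And>m l. N \<le> m \<Longrightarrow> N \<le> l \<Longrightarrow> D (y m) (y l) < \<epsilon> / max C 1"
      by blast
    have "dist (y m i) (y l i) < \<epsilon>" if "N \<le> m" "N \<le> l" for m l
      using D_lower'[of "y m" i "y l"] N[OF that] by (simp add: field_simps)
    then show "\<exists>M. \<forall>m\<ge>M. \<forall>n\<ge>M. dist (y m i) (y n i) < \<epsilon>" by blast
  qed
  moreover have y_mono: "monoseq (\<lambda>m. y m i)" for i
    using AB mixed_le_chain_coordinate[where y = y, OF step] by (auto simp: monoseq_iff)
  ultimately have "\<exists>l\<in>E. (\<lambda>m. y m i) \<longlonglongrightarrow> l" for i
    using T_ran(2) by (intro O_complete_shifted[OF E(1)]) (auto simp: y_Suc)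
  then obtain z where z: "\<And>i. z i \<in> E" "\<And>i. (\<lambda>m. y m i) \<longlonglongrightarrow> z i"
    by metis
  have lim: "tendsto_monoseq (\<lambda>m. y m i) (z i)" for i
    using y_mono z(2) by (simp add: tendsto_monoseq_def)
  have lim_Suc: "tendsto_monoseq (\<lambda>m. y (Suc m) i) (z i)" for i
    using y_mono[of i] LIMSEQ_Suc[OF z(2)[of i]] unfolding tendsto_monoseq_def monoseq_def
    by (meson Suc_le_mono)
  \<comment> \<open>Compatibility applies to the preimages \<open>x m\<close>: both
    \<open>g (x m i) = y m i\<close> and \<open>T (x m) i = y (Suc m) i\<close> converge
    monotonically to the same \<open>z i\<close>.\<close>
  have compat_lim: "(\<lambda>m. dist (g (T (x m) i)) (T (y m) i)) \<longlonglongrightarrow> 0" for i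
  proof -
    have "tendsto_monoseq (\<lambda>m. g (x m i)) (z i)" for i
      using lim[of i] by (simp add: y_def)
    moreover have "tendsto_monoseq (\<lambda>m. ast_map ast F (x m) i) (z i)" for i
      using lim_Suc[of i] by (simp add: y_Suc T_def)
    ultimately show ?thesis
      using compat[unfolded O_compatible_def, rule_format, of x z i]
      by (simp add: T_def y_def[abs_def])
  qed
  have g_lim: "(\<lambda>m. g (T (x m) i)) \<longlonglongrightarrow> g (z i)" for i
    using g lim_Suc[of i] unfolding O_continuous_def y_Suc by blast
  have T_lim: "(\<lambda>m. T (y m) i) \<longlonglongrightarrow> g (z i)" for i
  proof -
    have "(\<lambda>m. dist (g (T (x m) i)) (T (y m) i) + dist (g (T (x m) i)) (g (z i))) \<longlonglongrightarrow> 0"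
      using tendsto_add[OF compat_lim[of i]
          g_lim[of i, unfolded tendsto_dist_iff[of _ "g (z i)"]]] by simp
    from tendsto_sandwich[OF _ _ tendsto_const this]
    have "(\<lambda>m. dist (T (y m) i) (g (z i))) \<longlonglongrightarrow> 0"
      by (simp add: dist_triangle3)
    then show ?thesis
      by (simp add: tendsto_dist_iff[of _ "g (z i)"])
  qed
  have "(\<lambda>m. T (y m) i) \<longlonglongrightarrow> T z i" for i
    using FE
  proof
    assume "O_continuous_multi F"
    \<comment> \<open>Rearranging by \<open>ast i\<close> mixes increasing and decreasing
      coordinates, which \<open>O_continuous_multi\<close> permits.\<close>
    then have "(\<lambda>m. F (\<lambda>k. y m (ast i k))) \<longlonglongrightarrow> F (\<lambda>k. z (ast i k))"
      unfolding O_continuous_multi_def using lim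
      by (elim allE[of _ "\<lambda>m k. y m (ast i k)"] allE[of _ "\<lambda>k. z (ast i k)"]) simp
    then show ?thesis
      by (simp add: T_def ast_map_def)
  next
    assume MCB: "MCB g E"
    \<comment> \<open>The index starts at 1 because \<open>MCB\<close> speaks of sequences inside
      \<open>E\<close>.\<close>
    have le: "mixed_le A B (\<lambda>j. g (y (Suc m) j)) (\<lambda>j. g (z j))" for m
    proof -
      have "g (y (Suc m) j) \<le> g (z j)" if "j \<in> A" for j
      proof -
        have "tendsto_incseq (\<lambda>m. y (Suc m) j) (z j)"
          using mixed_le_chain_coordinate(1)[where y = y, OF step that] LIMSEQ_Suc[OF z(2)[of j]]
          by (simp add: tendsto_incseq_def incseq_Suc_iff)
        moreover have "\<forall>m. y (Suc m) j \<in> E"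
          by (simp add: y_Suc T_ran(2))
        ultimately show ?thesis
          using MCB z(1)[of j] unfolding MCB_def by meson
      qed
      moreover have "g (z j) \<le> g (y (Suc m) j)" if "j \<in> B" for j
      proof -
        have "tendsto_decseq (\<lambda>m. y (Suc m) j) (z j)"
          using mixed_le_chain_coordinate(2)[where y = y, OF step that] LIMSEQ_Suc[OF z(2)[of j]]
          by (simp add: tendsto_decseq_def decseq_Suc_iff)
        moreover have "\<forall>m. y (Suc m) j \<in> E"
          by (simp add: y_Suc T_ran(2))
        ultimately show ?thesis
          using MCB z(1)[of j] unfolding MCB_def by meson
      qed
      ultimately show ?thesis by (simp add: mixed_le_def)
    qed
    \<comment> \<open>By \<open>D_upper\<close> this sum dominates the \<open>D\<close>-distance of
      the \<open>g\<close>-images of \<open>y (Suc m)\<close> and \<open>z\<close>; once it is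
      small, the Meir-Keeler condition for this comparable pair bounds the distance of their images
      under \<open>T\<close>.\<close>
    have "(\<lambda>m. \<Sum>j\<in>UNIV. dist (g (y (Suc m) j)) (g (z j))) \<longlonglongrightarrow> (\<Sum>j\<in>(UNIV :: 'n set). 0)"
      using g lim_Suc unfolding O_continuous_def
      by (intro tendsto_sum) (simp add: tendsto_dist_iff[symmetric])
    then have gD: "(\<lambda>m. \<Sum>j\<in>UNIV. dist (g (y (Suc m) j)) (g (z j))) \<longlonglongrightarrow> 0"
      by simp
    have "(\<lambda>m. T (y (Suc m)) i) \<longlonglongrightarrow> T z i"
    proof (rule tendstoI)
      fix \<epsilon> :: real assume "0 < \<epsilon>"
      then have "0 < \<epsilon> / max C 1" by auto
      from MK[OF this] obtain e where e: "e > 0"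
        "\<And>u v. mixed_le A B (\<lambda>i. g (u i)) (\<lambda>i. g (v i)) \<Longrightarrow>
        D (\<lambda>i. g (u i)) (\<lambda>i. g (v i)) < \<epsilon> / max C 1 + e \<Longrightarrow> D (T u) (T v) < \<epsilon> / max C 1"
        unfolding T_def by blast
      have "\<forall>\<^sub>F m in sequentially.
          (\<Sum>j\<in>UNIV. dist (g (y (Suc m) j)) (g (z j))) < \<epsilon> / max C 1 + e"
        using \<open>0 < \<epsilon> / max C 1\<close> e(1) by (intro order_tendstoD(2)[OF gD]) simp
      then show "\<forall>\<^sub>F m in sequentially. dist (T (y (Suc m)) i) (T z i) < \<epsilon>"
      proof eventually_elim
        case (elim m)
        then have "D (T (y (Suc m))) (T z) < \<epsilon> / max C 1"
          by (intro e(2) le le_less_trans[OF D_upper])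
        then show ?case
          using D_lower'[of "T (y (Suc m))" i "T z"] by (simp add: field_simps)
      qed
    qed
    then show ?thesis
      by (rule LIMSEQ_imp_Suc)
  qed
  then have "T z i = g (z i)" for i
    using T_lim LIMSEQ_unique by blast
  then show ?thesis
    unfolding ast_coincidence_point_def T_def by blast
qed

section \<open>From \<open>Omega\<close>-contractions to coincidence points\<close>

text \<open>At positive distance \<open>Omega_gap\<close> turns the contraction into the Meir-Keeler
  condition. At distance zero the order decides: equal \<open>g\<close>-images compare both ways, so
  monotonicity and antisymmetry make the images under \<open>ast_map ast F\<close> equal.\<close>

lemma Meir_Keeler_of_Omega:
  fixes A B :: "'n::finite set"
    and F :: "('n \<Rightarrow> 'a::{metric_space, order}) \<Rightarrow> 'a"
    and D :: "('n \<Rightarrow> 'a) \<Rightarrow> ('n \<Rightarrow> 'a) \<Rightarrow> real"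
  assumes AB: "A \<union> B = UNIV"
    and mono: "\<And>x y. mixed_le A B (\<lambda>i. g (x i)) (\<lambda>i. g (y i)) \<Longrightarrow>
                 mixed_le A B (ast_map ast F x) (ast_map ast F y)"
    and D_nonneg: "\<And>u v. 0 \<le> D u v"
    and D_refl: "\<And>u. D u u = 0"
    and D_lower: "\<And>u v i. dist (u i) (v i) \<le> C * D u v"
    and "\<phi> \<in> Omega"
    and contr: "\<And>x y. mixed_le A B (\<lambda>i. g (x i)) (\<lambda>i. g (y i)) \<Longrightarrow>
       D (ast_map ast F x) (ast_map ast F y) \<le> \<phi> (D (\<lambda>i. g (x i)) (\<lambda>i. g (y i)))"
    and "0 < \<epsilon>"
  shows "\<exists>e>0. \<forall>x y.
     mixed_le A B (\<lambda>i. g (x i)) (\<lambda>i. g (y i)) \<longrightarrow> D (\<lambda>i. g (x i)) (\<lambda>i. g (y i)) < \<epsilon> + e \<longrightarrow>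
     D (ast_map ast F x) (ast_map ast F y) < \<epsilon>"
proof -
  obtain e where e: "0 < e" "\<And>r. 0 < r \<Longrightarrow> r < \<epsilon> + e \<Longrightarrow> \<phi> r < \<epsilon>"
    using Omega_gap[OF \<open>\<phi> \<in> Omega\<close> \<open>0 < \<epsilon>\<close>] by blast
  have "D (ast_map ast F x) (ast_map ast F y) < \<epsilon>"
    if le: "mixed_le A B (\<lambda>i. g (x i)) (\<lambda>i. g (y i))"
      and lt: "D (\<lambda>i. g (x i)) (\<lambda>i. g (y i)) < \<epsilon> + e" for x y
  proof (cases "D (\<lambda>i. g (x i)) (\<lambda>i. g (y i)) = 0")
    case True
    \<comment> \<open>The contraction gives nothing here, because \<open>\<phi> 0\<close> may be positive.\<close>
    then have "(\<lambda>i. g (x i)) = (\<lambda>i. g (y i))"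
      using D_lower[of "\<lambda>i. g (x i)" _ "\<lambda>i. g (y i)"] by (simp add: fun_eq_iff)
    then have "mixed_le A B (\<lambda>i. g (y i)) (\<lambda>i. g (x i))"
      using le by simp
    then have "ast_map ast F x = ast_map ast F y"
      using mixed_le_antisym[OF AB] mono le by blast
    then show ?thesis using D_refl \<open>0 < \<epsilon>\<close> by simp
  next
    case False
    then have "0 < D (\<lambda>i. g (x i)) (\<lambda>i. g (y i))"
      using D_nonneg[of "\<lambda>i. g (x i)" "\<lambda>i. g (y i)"] by simp
    then show ?thesis using e(2) contr[OF le] lt by fastforce
  qed
  with e(1) show ?thesis by blast
qed

text \<open>A common frame for the averaged and the maximum distance. A starting point above its
  image is treated by exchanging \<open>A\<close> and \<open>B\<close>, under which the contraction
  hypothesis is invariant.\<close>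

lemma coincidence_of_Omega:
  fixes A B :: "'n::finite set"
    and F :: "('n \<Rightarrow> 'a::{metric_space, order}) \<Rightarrow> 'a"
    and D :: "('n \<Rightarrow> 'a) \<Rightarrow> ('n \<Rightarrow> 'a) \<Rightarrow> real"
  assumes AB: "A \<union> B = UNIV" and ast: "ast \<in> graded_ops A B"
    and E: "O_complete E" "range F \<subseteq> range g \<inter> E"
    and mixed: "mixed_g_monotone A B g F"
    and cont: "O_compatible ast F g" "O_continuous g" "O_continuous_multi F \<or> MCB g E"
    and x0: "mixed_le A B (\<lambda>i. g (x0 i)) (ast_map ast F x0) \<or>
              mixed_le A B (ast_map ast F x0) (\<lambda>i. g (x0 i))"
    and D_sym: "\<And>u v. D u v = D v u"
    and D_tri: "\<And>u v w. D u w \<le> D u v + D v w"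
    and D_lower: "\<And>u v i. dist (u i) (v i) \<le> C * D u v"
    and D_upper: "\<And>u v. D u v \<le> (\<Sum>i\<in>UNIV. dist (u i) (v i))"
    and \<phi>: "\<phi> \<in> Omega"
    and contr: "\<And>x y. mixed_le A B (\<lambda>i. g (x i)) (\<lambda>i. g (y i)) \<or>
            mixed_le A B (\<lambda>i. g (y i)) (\<lambda>i. g (x i)) \<Longrightarrow>
       D (ast_map ast F x) (ast_map ast F y) \<le> \<phi> (D (\<lambda>i. g (x i)) (\<lambda>i. g (y i)))"
  shows "\<exists>x. ast_coincidence_point ast F g x"
proof -
  have D_refl: "D u u = 0" for u
    using D_upper[of u u] D_tri[of u u u] by simp
  have D_nonneg: "0 \<le> D u v" for u v
    using D_tri[of u u v] D_sym[of u v] D_refl[of u] by simp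
  note mono = ast_map_mono[OF mixed AB ast]
  have BA: "B \<union> A = UNIV" using AB by auto
  have mono': "mixed_le B A (ast_map ast F x) (ast_map ast F y)"
    if "mixed_le B A (\<lambda>i. g (x i)) (\<lambda>i. g (y i))" for x y
    using that mono unfolding mixed_le_swap[of B A] by blast
  have contr': "D (ast_map ast F x) (ast_map ast F y) \<le> \<phi> (D (\<lambda>i. g (x i)) (\<lambda>i. g (y i)))"
    if "mixed_le B A (\<lambda>i. g (x i)) (\<lambda>i. g (y i))" for x y
    using that contr unfolding mixed_le_swap[of B A] by blast
  from x0 show ?thesis
  proof
    assume "mixed_le A B (\<lambda>i. g (x0 i)) (ast_map ast F x0)"
    from coincidence_of_Meir_Keeler[where D = D, OF AB E mono cont this D_sym D_tri D_lower D_upper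
        Meir_Keeler_of_Omega[where D = D, OF AB mono D_nonneg D_refl D_lower \<phi> contr[OF disjI1]]]
    show ?thesis .
  next
    assume "mixed_le A B (ast_map ast F x0) (\<lambda>i. g (x0 i))"
    then have "mixed_le B A (\<lambda>i. g (x0 i)) (ast_map ast F x0)"
      by (simp only: mixed_le_swap[of B A])
    from coincidence_of_Meir_Keeler[where D = D, OF BA E mono' cont this D_sym D_tri D_lower D_upper
        Meir_Keeler_of_Omega[where D = D, OF BA mono' D_nonneg D_refl D_lower \<phi> contr']]
    show ?thesis .
  qed
qed

theorem theorem1:
  fixes A B :: "'n::finite set"
    and ast :: "'n \<Rightarrow> 'n \<Rightarrow> 'n"
    and E :: "'a::{metric_space, order} set"
    and F :: "('n \<Rightarrow> 'a) \<Rightarrow> 'a"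
    and g :: "'a \<Rightarrow> 'a"
  assumes "CARD('n) \<ge> 2"
    and "bipartition A B"
    and "ast \<in> graded_ops A B"
    and "E \<noteq> {}" and "O_complete E"
    and "range F \<subseteq> range g \<inter> E"
    and "mixed_g_monotone A B g F"
    and "O_compatible ast F g"
    and "O_continuous g"
    and "O_continuous_multi F \<or> MCB g E"
    and "\<exists>x0. mixed_le A B (\<lambda>i. g (x0 i)) (ast_map ast F x0) \<or>
              mixed_le A B (ast_map ast F x0) (\<lambda>i. g (x0 i))"
    and "(\<exists>\<phi>\<in>Omega. \<forall>x y.
            mixed_le A B (\<lambda>i. g (x i)) (\<lambda>i. g (y i)) \<or>
            mixed_le A B (\<lambda>i. g (y i)) (\<lambda>i. g (x i)) \<longrightarrow>
            1 / real CARD('n) * (\<Sum>i\<in>UNIV. dist (ast_map ast F x i) (ast_map ast F y i))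
              \<le> \<phi> (1 / real CARD('n) * (\<Sum>i\<in>UNIV. dist (g (x i)) (g (y i))))) \<or>
         (\<exists>\<phi>\<in>Omega. \<forall>x y.
            mixed_le A B (\<lambda>i. g (x i)) (\<lambda>i. g (y i)) \<or>
            mixed_le A B (\<lambda>i. g (y i)) (\<lambda>i. g (x i)) \<longrightarrow>
            (MAX i\<in>UNIV. dist (ast_map ast F x i) (ast_map ast F y i))
              \<le> \<phi> (MAX i\<in>UNIV. dist (g (x i)) (g (y i))))"
  shows "\<exists>x. ast_coincidence_point ast F g x"
proof -
  have AB: "A \<union> B = UNIV"
    using assms(2) by (simp add: bipartition_def)
  obtain x0 where x0: "mixed_le A B (\<lambda>i. g (x0 i)) (ast_map ast F x0) \<or>
              mixed_le A B (ast_map ast F x0) (\<lambda>i. g (x0 i))"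
    using assms(11) by blast
  note common = AB assms(3,5-10) x0
  from assms(12) show ?thesis
  proof (elim disjE bexE)
    fix \<phi> assume \<phi>: "\<phi> \<in> Omega"
      and contr: "\<forall>x y.
            mixed_le A B (\<lambda>i. g (x i)) (\<lambda>i. g (y i)) \<or>
            mixed_le A B (\<lambda>i. g (y i)) (\<lambda>i. g (x i)) \<longrightarrow>
            1 / real CARD('n) * (\<Sum>i\<in>UNIV. dist (ast_map ast F x i) (ast_map ast F y i))
              \<le> \<phi> (1 / real CARD('n) * (\<Sum>i\<in>UNIV. dist (g (x i)) (g (y i))))"
    define D :: "('n \<Rightarrow> 'a) \<Rightarrow> ('n \<Rightarrow> 'a) \<Rightarrow> real"
      where "D u v = 1 / real CARD('n) * (\<Sum>i\<in>UNIV. dist (u i) (v i))" for u v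
    show ?thesis
    \<comment> \<open>A single coordinate distance is at most the full sum, which is
      \<open>CARD('n)\<close> times the average; hence this \<open>C\<close>.\<close>
    proof (rule coincidence_of_Omega[where D = D and C = "real CARD('n)", OF common _ _ _ _ \<phi>])
      fix u v w :: "'n \<Rightarrow> 'a" and i
      show "D u v = D v u"
        by (simp add: D_def dist_commute)
      have "(\<Sum>i\<in>UNIV. dist (u i) (w i)) \<le> (\<Sum>i\<in>UNIV. dist (u i) (v i) + dist (v i) (w i))"
        by (intro sum_mono dist_triangle)
      then show "D u w \<le> D u v + D v w"
        by (simp add: D_def sum.distrib add_divide_distrib[symmetric] divide_right_mono)
      show "dist (u i) (v i) \<le> real CARD('n) * D u v"
        using member_le_sum[of i UNIV "\<lambda>i. dist (u i) (v i)"] by (simp add: D_def)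
      show "D u v \<le> (\<Sum>i\<in>UNIV. dist (u i) (v i))"
        unfolding D_def by (intro mult_left_le_one_le) (auto simp: sum_nonneg)
    qed (unfold D_def, use contr in blast)
  next
    fix \<phi> assume \<phi>: "\<phi> \<in> Omega"
      and contr: "\<forall>x y.
            mixed_le A B (\<lambda>i. g (x i)) (\<lambda>i. g (y i)) \<or>
            mixed_le A B (\<lambda>i. g (y i)) (\<lambda>i. g (x i)) \<longrightarrow>
            (MAX i\<in>UNIV. dist (ast_map ast F x i) (ast_map ast F y i))
              \<le> \<phi> (MAX i\<in>UNIV. dist (g (x i)) (g (y i)))"
    define D :: "('n \<Rightarrow> 'a) \<Rightarrow> ('n \<Rightarrow> 'a) \<Rightarrow> real"
      where "D u v = (MAX i\<in>UNIV. dist (u i) (v i))" for u v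
    have D_ge: "dist (u i) (v i) \<le> D u v" for u v i
      unfolding D_def by (intro Max_ge) auto
    show ?thesis
    \<comment> \<open>The maximum already dominates each coordinate distance, so the constant is
      1.\<close>
    proof (rule coincidence_of_Omega[where D = D and C = 1, OF common _ _ _ _ \<phi>])
      fix u v w :: "'n \<Rightarrow> 'a" and i
      show "D u v = D v u"
        by (simp add: D_def dist_commute)
      have "dist (u i) (w i) \<le> D u v + D v w" for i
        using dist_triangle[of "u i" "w i" "v i"] D_ge[of u i v] D_ge[of v i w] by linarith
      then show "D u w \<le> D u v + D v w"
        unfolding D_def[of u w] by (subst Max_le_iff) auto
      show "dist (u i) (v i) \<le> 1 * D u v"
        using D_ge by simp
      show "D u v \<le> (\<Sum>i\<in>UNIV. dist (u i) (v i))"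
        using member_le_sum[of _ UNIV "\<lambda>i. dist (u i) (v i)"]
        unfolding D_def by (subst Max_le_iff) auto
    qed (unfold D_def, use contr in blast)
  qed
qed

end
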